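(* For all $k\geq 1$, $AR_{FF}(P_k) = \frac{k^2}{8}(1+o(1))$, where $P_k$ is the path with $k$ edges and $o(1)$ is a function of $k$ tending to $0$ as $k\to\infty$.
   Context: All graphs are finite and simple. An edge-colored graph is rainbow if all its edges have distinct colors. A copy of $H$ is a (not necessarily induced) subgraph isomorphic to $H$. $AR_{FF}(H)$ (First-Fit anti-Ramsey number): Builder presents vertices and edges of a simple graph, one edge at a time, and each new edge is immediately colored by Painter with the smallest color in $\{1,2,\ldots\}$ not used on an adjacent edge already presented (First-Fit). $AR_{FF}(H)$ is the smallest $t$ such that Builder can present $t$ edges so that the resulting colored graph contains a rainbow copy of $H$. *)

theory Defs
  imports Complex_Main
begin

type_synonym 'a graph = "'a set \<times> 'a set set"

abbreviation verts :: "'a graph \<Rightarrow> 'a set" where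
  "verts G \<equiv> fst G"

abbreviation edges :: "'a graph \<Rightarrow> 'a set set" where
  "edges G \<equiv> snd G"

definition simple_graph :: "'a graph \<Rightarrow> bool" where
  "simple_graph G \<longleftrightarrow>
     finite (verts G) \<and> (\<forall>e\<in>edges G. e \<subseteq> verts G \<and> card e = 2)"

definition subgraph :: "'a graph \<Rightarrow> 'a graph \<Rightarrow> bool" where
  "subgraph K G \<longleftrightarrow> simple_graph K \<and> verts K \<subseteq> verts G \<and> edges K \<subseteq> edges G"

definition isomorphic :: "'a graph \<Rightarrow> 'b graph \<Rightarrow> bool" where
  "isomorphic H K \<longleftrightarrow>
     (\<exists>f. bij_betw f (verts H) (verts K) \<and> edges K = (\<lambda>e. f ` e) ` edges H)"

definition is_copy :: "'a graph \<Rightarrow> 'b graph \<Rightarrow> 'b graph \<Rightarrow> bool" where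
  "is_copy H G K \<longleftrightarrow> subgraph K G \<and> isomorphic H K"

definition adjacent_edges :: "'a set \<Rightarrow> 'a set \<Rightarrow> bool" where
  "adjacent_edges e f \<longleftrightarrow> e \<noteq> f \<and> e \<inter> f \<noteq> {}"

text \<open>
  A partial edge colouring is a map whose domain is the set of edges presented so far.
\<close>

definition first_fit_step ::
  "('a set \<Rightarrow> nat option) \<Rightarrow> 'a set \<Rightarrow> ('a set \<Rightarrow> nat option)" where
  "first_fit_step c e =
     c(e \<mapsto> (LEAST i. 1 \<le> i \<and> (\<forall>f\<in>dom c. adjacent_edges e f \<longrightarrow> c f \<noteq> Some i)))"

definition first_fit :: "'a set list \<Rightarrow> ('a set \<Rightarrow> nat option)" where
  "first_fit es = foldl first_fit_step Map.empty es"

definition presents :: "'a set list \<Rightarrow> 'a graph \<Rightarrow> bool" where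
  "presents es G \<longleftrightarrow> simple_graph G \<and> distinct es \<and> set es = edges G"

definition rainbow :: "('a set \<Rightarrow> nat option) \<Rightarrow> 'a graph \<Rightarrow> bool" where
  "rainbow c K \<longleftrightarrow> inj_on c (edges K)"

text \<open>
  Painter is deterministic, so a strategy of Builder amounts to a finite graph together with
  an order in which its edges are presented. The times at which vertices are presented do
  not affect the colouring, and every finite graph has an isomorphic copy on natural numbers.
\<close>

definition AR_FF :: "'a graph \<Rightarrow> nat" where
  "AR_FF H =
     (LEAST t. \<exists>(G :: nat graph) es.
        presents es G \<and> length es = t \<and>
        (\<exists>K. is_copy H G K \<and> rainbow (first_fit es) K))"

definition path_graph :: "nat \<Rightarrow> nat graph" where
  "path_graph k = ({0..k}, {{i, Suc i} | i. i < k})"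

end

theory Submission
  imports Defs
begin

text \<open>
  Lower bound: an edge of colour \<open>c\<close> meets edges of all colours \<open>1, \<dots>, c\<close>, so its end
  degrees add up to at least \<open>c\<close>. Summing over a rainbow path gives
  \<open>k\<^sup>2 / 2 \<le> 2 \<Sum> d(v) \<le> 4 |E|\<close>, the sum being over the vertices of the path.

  Upper bound: on the vertices \<open>0, 1, \<dots>\<close>, join \<open>u < v\<close> whenever \<open>u\<close> is even,
  \<open>v \<noteq> u + 1\<close> and \<open>u + v < N\<close>, and give this edge the colour \<open>N - u - v\<close>. The end \<open>u\<close> sees all
  smaller colours, so First-Fit realises this colouring, and there are about \<open>N\<^sup>2 / 8\<close> edges.
  Among the larger colours up to about \<open>N - u\<close>, a vertex \<open>u\<close> sees those of the parity of
  \<open>N - u\<close>; hence \<open>n\<close> and \<open>n + 1\<close> together see all of \<open>1, \<dots>, N - n\<close> except a bounded number of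
  colours, which a linear number of additional edges supplies. The edge \<open>{n, n + 1}\<close>
  then receives the colour \<open>N + 1 - n\<close>, so the path through the consecutive integers is
  rainbow.
\<close>

section \<open>First-Fit and greedy colourings\<close>

text \<open>These are the Grundy colourings of the line graph: proper, and each edge sees every
  smaller colour.\<close>

definition greedy_coloring :: "'a set set \<Rightarrow> ('a set \<Rightarrow> nat) \<Rightarrow> bool" where
  "greedy_coloring E col \<longleftrightarrow>
     (\<forall>e\<in>E. 1 \<le> col e \<and> (\<forall>f\<in>E. adjacent_edges e f \<longrightarrow> col f \<noteq> col e) \<and>
        (\<forall>j. 1 \<le> j \<and> j < col e \<longrightarrow> (\<exists>f\<in>E. adjacent_edges e f \<and> col f = j)))"

lemma dom_first_fit: "dom (first_fit es) = set es"
proof (induction es rule: rev_induct)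
  case Nil
  show ?case by (simp add: first_fit_def)
next
  case (snoc e es)
  then show ?case by (simp add: first_fit_def first_fit_step_def del: fun_upd_apply)
qed

lemma first_fit_snoc:
  "\<exists>i. first_fit (es @ [e]) = (first_fit es)(e \<mapsto> i) \<and> 1 \<le> i \<and>
    (\<forall>f\<in>set es. adjacent_edges e f \<longrightarrow> first_fit es f \<noteq> Some i) \<and>
    (\<forall>j. 1 \<le> j \<and> j < i \<longrightarrow> (\<exists>f\<in>set es. adjacent_edges e f \<and> first_fit es f = Some j))"
proof -
  let ?c = "first_fit es"
  define P where "P i \<longleftrightarrow> 1 \<le> i \<and> (\<forall>f\<in>set es. adjacent_edges e f \<longrightarrow> ?c f \<noteq> Some i)" for i
  \<comment> \<open>Only finitely many colours are in use, so a fresh positive one exists. Hence the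
    \<open>LEAST\<close> in \<open>first_fit_step\<close> is attained.\<close>
  have "finite (insert 0 ((the \<circ> ?c) ` set es))" by simp
  then obtain i0 where i0: "i0 \<notin> insert 0 ((the \<circ> ?c) ` set es)"
    using ex_new_if_finite infinite_UNIV_nat by blast
  have "?c f \<noteq> Some i0" if "f \<in> set es" for f
  proof
    assume "?c f = Some i0"
    then have "i0 = (the \<circ> ?c) f" by simp
    then show False using i0 that by blast
  qed
  then have "P i0" using i0 by (auto simp: P_def)
  then have "P (Least P)" by (rule LeastI)
  moreover have "\<exists>f\<in>set es. adjacent_edges e f \<and> ?c f = Some j" if "1 \<le> j" "j < Least P" for j
    using not_less_Least[OF that(2)] that(1) by (auto simp: P_def)
  moreover have "first_fit (es @ [e]) = ?c(e \<mapsto> Least P)"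
    using dom_first_fit[of es] by (simp add: first_fit_def first_fit_step_def P_def[abs_def])
  ultimately show ?thesis by (intro exI[of _ "Least P"]) (simp add: P_def)
qed

text \<open>With distinct edges nothing is ever recoloured, so the neighbours that blocked the
  smaller colours when \<open>e\<close> was presented keep their colours.\<close>

lemma first_fit_color:
  assumes "distinct es" "e \<in> set es"
  shows "\<exists>i. first_fit es e = Some i \<and> 1 \<le> i \<and>
    (\<forall>j. 1 \<le> j \<and> j < i \<longrightarrow> (\<exists>f\<in>set es. adjacent_edges e f \<and> first_fit es f = Some j))"
  using assms
proof (induction es rule: rev_induct)
  case (snoc x es)
  obtain i where i: "first_fit (es @ [x]) = (first_fit es)(x \<mapsto> i)" "1 \<le> i"
    "\<forall>f\<in>set es. adjacent_edges x f \<longrightarrow> first_fit es f \<noteq> Some i"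
    "\<forall>j. 1 \<le> j \<and> j < i \<longrightarrow>
       (\<exists>f\<in>set es. adjacent_edges x f \<and> first_fit es f = Some j)"
    using first_fit_snoc[of es x] by (elim exE conjE) (rule that)
  have x: "x \<notin> set es" using snoc.prems by simp
  then have old: "first_fit (es @ [x]) f = first_fit es f" if "f \<in> set es" for f
    using i(1) that by auto
  show ?case
  proof (cases "e = x")
    case True
    have "\<exists>f\<in>set (es @ [x]). adjacent_edges e f \<and> first_fit (es @ [x]) f = Some j"
      if "1 \<le> j" "j < i" for j
      using i(4) that old True by auto
    then show ?thesis using i(1,2) True by auto
  next
    case False
    then have "e \<in> set es" "distinct es" using snoc.prems by auto
    then obtain l where l: "first_fit es e = Some l" "1 \<le> l"
      "\<And>j. 1 \<le> j \<Longrightarrow> j < l \<Longrightarrow>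
         \<exists>f\<in>set es. adjacent_edges e f \<and> first_fit es f = Some j"
      using snoc.IH by blast
    have "\<exists>f\<in>set (es @ [x]). adjacent_edges e f \<and> first_fit (es @ [x]) f = Some j"
      if "1 \<le> j" "j < l" for j
      using l(3)[OF that] old by auto
    then show ?thesis using l(1,2) old \<open>e \<in> set es\<close> by auto
  qed
qed simp

text \<open>Presenting edges in order of increasing colour makes all blocking neighbours available
  in time. The last edge has maximal colour, so it never serves as the neighbour of smaller colour,
  and the prefix is again greedily coloured.\<close>

lemma first_fit_sorted:
  assumes "distinct es" "sorted (map col es)" "greedy_coloring (set es) col" "e \<in> set es"
  shows "first_fit es e = Some (col e)"
  using assms
proof (induction es arbitrary: e rule: rev_induct)
  case (snoc x es)
  have x: "x \<notin> set es" and dist: "distinct es" and sorted: "sorted (map col es)"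
    and le: "\<And>f. f \<in> set es \<Longrightarrow> col f \<le> col x"
    using snoc.prems(1,2) by (auto simp: sorted_append)
  have g: "1 \<le> col f" "\<And>h. h \<in> set (es @ [x]) \<Longrightarrow> adjacent_edges f h \<Longrightarrow> col h \<noteq> col f"
    "\<And>j. 1 \<le> j \<Longrightarrow> j < col f \<Longrightarrow> \<exists>h\<in>set (es @ [x]). adjacent_edges f h \<and> col h = j"
    if "f \<in> set (es @ [x])" for f
    using snoc.prems(3) that unfolding greedy_coloring_def by blast+
  have g3: "\<exists>h\<in>set es. adjacent_edges f h \<and> col h = j"
    if f: "f \<in> set (es @ [x])" and j: "1 \<le> j" "j < col f" for f j
  proof -
    obtain h where h: "h \<in> set (es @ [x])" "adjacent_edges f h" "col h = j"
      using g(3)[OF f j] by blast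
    have "col f \<le> col x" using f le by auto
    then have "h \<noteq> x" using h(3) j(2) by auto
    then show ?thesis using h by auto
  qed
  have "greedy_coloring (set es) col"
    unfolding greedy_coloring_def using g(1,2) g3 by simp
  then have old: "first_fit es f = Some (col f)" if "f \<in> set es" for f
    using snoc.IH[OF dist sorted] that by blast
  obtain i where i: "first_fit (es @ [x]) = (first_fit es)(x \<mapsto> i)" "1 \<le> i"
    "\<forall>f\<in>set es. adjacent_edges x f \<longrightarrow> first_fit es f \<noteq> Some i"
    "\<forall>j. 1 \<le> j \<and> j < i \<longrightarrow>
       (\<exists>f\<in>set es. adjacent_edges x f \<and> first_fit es f = Some j)"
    using first_fit_snoc[of es x] by (elim exE conjE) (rule that)
  have "\<not> i < col x"
    using g3[of x i] i(2,3) old by fastforce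
  moreover have "\<not> col x < i"
    using i(4) g(1,2)[of x] old by fastforce
  ultimately have "i = col x" by simp
  then show ?case using i(1) old snoc.prems(4) by auto
qed simp

lemma first_fit_realizes_greedy_coloring:
  assumes "finite E" "greedy_coloring E col"
  obtains es where "distinct es" "set es = E" "\<And>e. e \<in> E \<Longrightarrow> first_fit es e = Some (col e)"
proof -
  obtain xs where "set xs = E" "distinct xs" using finite_distinct_list[OF assms(1)] by blast
  then have "distinct (sort_key col xs)" "set (sort_key col xs) = E" by simp_all
  then show thesis
    using first_fit_sorted[of "sort_key col xs" col] assms(2)
    by (intro that[of "sort_key col xs"]) simp_all
qed

section \<open>The lower bound\<close>

text \<open>Each smaller colour occurs on an edge adjacent to \<open>e\<close>. Since
  \<open>adjacent_edges\<close> excludes \<open>e\<close> itself, the top colour is contributed by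
  \<open>e\<close>, which meets itself because it is nonempty.\<close>

lemma color_le_card_incident:
  assumes "distinct es" "e \<in> set es" "e \<noteq> {}"
  shows "the (first_fit es e) \<le> card {f \<in> set es. f \<inter> e \<noteq> {}}"
proof -
  obtain i where i: "first_fit es e = Some i"
    "\<And>j. 1 \<le> j \<Longrightarrow> j < i \<Longrightarrow> \<exists>f\<in>set es. adjacent_edges e f \<and> first_fit es f = Some j"
    using first_fit_color[OF assms(1,2)] by blast
  have "{1..i} \<subseteq> (the \<circ> first_fit es) ` {f \<in> set es. f \<inter> e \<noteq> {}}"
  proof
    fix j assume j: "j \<in> {1..i}"
    have "\<exists>f\<in>set es. f \<inter> e \<noteq> {} \<and> first_fit es f = Some j"
    proof (cases "j = i")
      case True
      then show ?thesis using i(1) assms by auto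
    next
      case False
      then show ?thesis using i(2)[of j] j by (fastforce simp: adjacent_edges_def)
    qed
    then show "j \<in> (the \<circ> first_fit es) ` {f \<in> set es. f \<inter> e \<noteq> {}}" by force
  qed
  then have "card {1..i} \<le> card {f \<in> set es. f \<inter> e \<noteq> {}}"
    by (intro surj_card_le) auto
  then show ?thesis using i(1) by simp
qed

lemma rainbow_path_lower_bound:
  fixes G :: "'a graph"
  assumes G: "presents es G" and K: "is_copy (path_graph k) G K"
    and rb: "rainbow (first_fit es) K"
  shows "k * k \<le> 8 * length es"
proof -
  have es: "distinct es" "set es = edges G" and sg: "simple_graph G"
    using G by (auto simp: presents_def)
  obtain p where p: "bij_betw p {0..k} (verts K)"
    and eK: "edges K = (\<lambda>e. p ` e) ` {{i, Suc i} |i. i < k}"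
    using K by (auto simp: is_copy_def isomorphic_def path_graph_def)
  have sub: "edges K \<subseteq> edges G" "simple_graph K" using K by (auto simp: is_copy_def subgraph_def)
  have inj: "inj_on p {0..k}" using p by (simp add: bij_betw_def)
  define q where "q i = {p i, p (Suc i)}" for i
  define d where "d v = card {f \<in> edges G. v \<in> f}" for v
  have fin: "finite (edges G)" using es(2) by (metis List.finite_set)
  have eK': "edges K = q ` {..<k}"
  proof -
    have "{{i, Suc i} |i. i < k} = (\<lambda>i. {i, Suc i}) ` {..<k}" by auto
    then show ?thesis unfolding eK q_def by (simp add: image_image)
  qed
  have "finite (edges K)" using eK' by simp
  have inj_q: "inj_on q {..<k}"
  proof (rule inj_onI)
    fix i j assume ij: "i \<in> {..<k}" "j \<in> {..<k}" "q i = q j"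
    then have "{i, Suc i} = {j, Suc j}"
      using inj_on_image_eq_iff[OF inj, of "{i, Suc i}" "{j, Suc j}"] by (auto simp: q_def)
    then show "i = j" by (auto simp: doubleton_eq_iff)
  qed
  define col where "col e = the (first_fit es e)" for e
  have col: "first_fit es e = Some (col e)" "1 \<le> col e" if "e \<in> edges G" for e
    using first_fit_color[OF es(1), of e] that es(2) by (auto simp: col_def)
  have inj_col: "inj_on col (edges K)"
  proof (rule inj_onI)
    fix e f assume ef: "e \<in> edges K" "f \<in> edges K" "col e = col f"
    then have "first_fit es e = first_fit es f" using col(1) sub(1) by (simp add: subset_iff)
    then show "e = f" using rb ef(1,2) by (simp add: rainbow_def inj_on_def)
  qed
  define C where "C = col ` edges K"
  have "card C = k"
    unfolding C_def using card_image[OF inj_col] card_image[OF inj_q] eK' by simp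
  have "0 \<notin> C" unfolding C_def using col(2) sub(1) by force
  have "finite C" unfolding C_def using \<open>finite (edges K)\<close> by simp
  \<comment> \<open>The colours are \<open>k\<close> distinct positive numbers, so they sum to at
    least \<open>1 + ... + k\<close>. Inserting 0 fits \<open>card_sum_le_nat_sum\<close>, which
    compares with sums starting at 0.\<close>
  have "k * k \<le> 2 * \<Sum>{0..<card (insert 0 C)}"
    using \<open>card C = k\<close> \<open>0 \<notin> C\<close> \<open>finite C\<close> gauss_sum_nat[of k]
    by (simp add: atLeastLessThanSuc_atLeastAtMost)
  also have "\<dots> \<le> 2 * \<Sum>(insert 0 C)"
    by (intro mult_left_mono card_sum_le_nat_sum) auto
  also have "\<Sum>(insert 0 C) = (\<Sum>i<k. col (q i))"
    unfolding C_def using \<open>finite (edges K)\<close> sum.reindex[OF inj_col, of id] sum.reindex[OF inj_q, of col]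
      eK' by (simp add: sum.insert_if)
  also have "(\<Sum>i<k. col (q i)) \<le> (\<Sum>i<k. d (p i) + d (p (Suc i)))"
  proof (rule sum_mono)
    fix i assume "i \<in> {..<k}"
    then have "q i \<in> set es" using eK' sub(1) es(2) by auto
    then have "col (q i) \<le> card {f \<in> edges G. f \<inter> q i \<noteq> {}}"
      using color_le_card_incident[OF es(1), of "q i"] es(2) by (simp add: col_def q_def)
    also have "{f \<in> edges G. f \<inter> q i \<noteq> {}} = {f \<in> edges G. p i \<in> f} \<union> {f \<in> edges G. p (Suc i) \<in> f}"
      by (auto simp: q_def)
    also have "card \<dots> \<le> d (p i) + d (p (Suc i))" unfolding d_def by (rule card_Un_le)
    finally show "col (q i) \<le> d (p i) + d (p (Suc i))" .
  qed
  \<comment> \<open>Every vertex of the path is an end of at most two path edges.\<close>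
  also have "\<dots> \<le> 2 * (\<Sum>i\<in>{0..k}. d (p i))"
  proof -
    have "(\<Sum>i<k. d (p i)) \<le> (\<Sum>i\<in>{0..k}. d (p i))" by (rule sum_mono2) auto
    moreover have "(\<Sum>i<k. d (p (Suc i))) \<le> (\<Sum>i\<in>{0..k}. d (p i))"
      using sum.atMost_Suc_shift[of "\<lambda>i. d (p i)" "k - 1"]
      by (cases k) (auto simp: atLeast0AtMost lessThan_Suc_atMost)
    ultimately show ?thesis by (simp add: sum.distrib)
  qed
  also have "(\<Sum>i\<in>{0..k}. d (p i)) = (\<Sum>v\<in>verts K. d v)"
    using sum.reindex_bij_betw[OF p, of d] .
  also have "\<dots> = (\<Sum>v\<in>verts K. \<Sum>f\<in>edges G. if v \<in> f then 1 else 0)"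
    unfolding d_def using fin by (intro sum.cong refl) (simp add: sum.If_cases Int_def)
  \<comment> \<open>Double counting of incidences: an edge of \<open>G\<close> has at most two ends
    on the path.\<close>
  also have "\<dots> = (\<Sum>f\<in>edges G. \<Sum>v\<in>verts K. if v \<in> f then 1 else 0)" by (rule sum.swap)
  also have "\<dots> \<le> (\<Sum>f\<in>edges G. 2)"
  proof (rule sum_mono)
    fix f assume f: "f \<in> edges G"
    have "finite (verts K)" using sub(2) by (simp add: simple_graph_def)
    then have "(\<Sum>v\<in>verts K. if v \<in> f then 1 else 0) = card (verts K \<inter> f)"
      by (simp add: sum.If_cases Int_def)
    also have "\<dots> \<le> card f"
      using f sg by (intro card_mono) (auto simp: simple_graph_def intro: finite_subset)
    also have "card f = 2" using f sg by (simp add: simple_graph_def)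
    finally show "(\<Sum>v\<in>verts K. if v \<in> f then 1 else 0) \<le> (2::nat)" .
  qed
  also have "\<dots> = 2 * length es" using es distinct_card[of es] by simp
  finally show ?thesis by simp
qed

section \<open>The construction\<close>

text \<open>
  The edges are written as pairs \<open>u < v\<close>. The last disjunct describes the additional edges: they
  lead to four vertices \<open>N + 2 + d\<close> outside the range of the others.
\<close>

definition arc :: "nat \<Rightarrow> nat \<Rightarrow> nat \<Rightarrow> bool" where
  "arc N u v \<longleftrightarrow> even u \<and> u + 1 < v \<and> u + v < N \<or> 4 \<le> u \<and> v = u + 1 \<and> u \<le> N \<or>
     even u \<and> 4 \<le> u \<and> (\<exists>d\<in>{0, 1, 2, 4}. v = N + 2 + d \<and> 2 * u + 2 \<le> N + d)"

definition arc_color :: "nat \<Rightarrow> nat \<Rightarrow> nat \<Rightarrow> nat" where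
  "arc_color N u v =
     (if N + 2 \<le> v then v - 3 - 2 * u else if v = u + 1 then N + 1 - u else N - u - v)"

section \<open>The arc colouring is greedy\<close>

lemma arc_less: "arc N u v \<Longrightarrow> u < v"
  and arc_bound: "arc N u v \<Longrightarrow> v < N + 7"
  and arc_color_pos: "arc N u v \<Longrightarrow> 1 \<le> arc_color N u v"
  by (auto simp: arc_def arc_color_def)

text \<open>The additive equations avoid truncated subtraction, so that linear arithmetic applies.
  The condition \<open>v \<noteq> N + 5\<close> expresses that \<open>d\<close> is never 3.\<close>

lemma arc_cases:
  assumes "arc N u v" "arc_color N u v = c"
  obtains (sum) "even u" "u + 1 < v" "v < N" "u + v + c = N"
    | (path) "4 \<le> u" "v = u + 1" "v < N + 2" "u + c = N + 1"
    | (extra) "even u" "4 \<le> u" "N + 2 \<le> v" "v \<noteq> N + 5" "v \<le> N + 6" "2 * u + 3 + c = v"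
proof -
  consider "even u" "u + 1 < v" "u + v < N" | "4 \<le> u" "v = u + 1" "u \<le> N"
    | d where "even u" "4 \<le> u" "d = 0 \<or> d = 1 \<or> d = 2 \<or> d = 4" "v = N + 2 + d" "2 * u + 2 \<le> N + d"
    using assms(1) unfolding arc_def by blast
  then show thesis
  proof cases
    case 1
    then show thesis using assms(2) by (intro sum) (auto simp: arc_color_def)
  next
    case 2
    then show thesis using assms(2) by (intro path) (auto simp: arc_color_def)
  next
    case 3
    then show thesis using assms(2) by (intro extra) (auto simp: arc_color_def)
  qed
qed

lemma arc_sumI: "even u \<Longrightarrow> u + 1 < v \<Longrightarrow> u + v + c = N \<Longrightarrow> 1 \<le> c \<Longrightarrow>
    arc N u v \<and> arc_color N u v = c"
  by (auto simp: arc_def arc_color_def)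

lemma arc_extraI: "even u \<Longrightarrow> 4 \<le> u \<Longrightarrow> d \<in> {0, 1, 2, 4} \<Longrightarrow> 2 * u + 1 + c = N + d \<Longrightarrow> 1 \<le> c \<Longrightarrow>
    arc N u (N + 2 + d) \<and> arc_color N u (N + 2 + d) = c"
  by (auto simp: arc_def arc_color_def)

text \<open>Two \<open>sum\<close> edges of equal colour at a vertex have the same other end.
  \<open>path\<close> edges at \<open>n\<close> have colour at least \<open>N + 1 - n\<close>, above
  all \<open>sum\<close> colours at \<open>n\<close> and, since \<open>4 \<le> u\<close>, above the
  \<open>extra\<close> colours. An \<open>extra\<close> edge takes the colour of a partner that
  \<open>u\<close> lacks; at its new vertex the colour determines \<open>u\<close>.\<close>

lemma arc_color_proper:
  assumes "arc N a b" "arc_color N a b = x" and cd: "arc N c d" "arc_color N c d = x"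
    and "{a, b} \<inter> {c, d} \<noteq> {}"
  shows "a = c \<and> b = d"
proof -
  have *: "a = c \<or> a = d \<or> b = c \<or> b = d" using assms(5) by auto
  from assms(1,2) show ?thesis
  proof (cases rule: arc_cases)
    case ab: sum
    from cd show ?thesis
      by (cases rule: arc_cases; use ab * in \<open>elim disjE; clarsimp elim!: evenE; presburger\<close>)
  next
    case ab: path
    from cd show ?thesis
      by (cases rule: arc_cases; use ab * in \<open>elim disjE; clarsimp elim!: evenE; presburger\<close>)
  next
    case ab: extra
    from cd show ?thesis
      by (cases rule: arc_cases; use ab * in \<open>elim disjE; clarsimp elim!: evenE; presburger\<close>)
  qed
qed

text \<open>The natural partner of \<open>u\<close> for colour \<open>c\<close> is
  \<open>N - u - c\<close>. It is admissible from \<open>u + 2\<close> upwards, and so is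
  \<open>u - 2\<close>, being even. The inadmissible values \<open>u + 1\<close>, \<open>u\<close>,
  \<open>u - 1\<close>, \<open>u - 3\<close> are replaced by the extra edges with \<open>d\<close>
  equal to 0, 1, 2, 4.\<close>

lemma even_vertex_sees_colors:
  assumes "even u" "4 \<le> u" "1 \<le> c" "c + 2 * u \<le> N + 3"
  shows "\<exists>v. (arc N u v \<and> arc_color N u v = c) \<or> (arc N v u \<and> arc_color N v u = c)"
proof -
  consider "c + 2 * u + 2 \<le> N" | "c + 2 * u = N + 2"
    | "c + 2 * u + 1 = N" | "c + 2 * u = N" | "c + 2 * u = N + 1" | "c + 2 * u = N + 3"
    using assms(4) by linarith
  then show ?thesis
  proof cases
    case 1
    then have "arc N u (N - u - c) \<and> arc_color N u (N - u - c) = c"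
      using assms by (intro arc_sumI) auto
    then show ?thesis by blast
  next
    case 2
    then have "arc N (u - 2) u \<and> arc_color N (u - 2) u = c"
      using assms by (intro arc_sumI) auto
    then show ?thesis by blast
  next
    case 3
    then show ?thesis using arc_extraI[of u 0 c N] assms by auto
  next
    case 4
    then show ?thesis using arc_extraI[of u 1 c N] assms by auto
  next
    case 5
    then show ?thesis using arc_extraI[of u 2 c N] assms by auto
  next
    case 6
    then show ?thesis using arc_extraI[of u 4 c N] assms by auto
  qed
qed

text \<open>For \<open>sum\<close> and \<open>extra\<close> edges the even end \<open>u\<close> sees
  everything needed. For a \<open>path\<close> edge the even end \<open>e\<close> sees the colours
  up to \<open>N + 3 - 2 * e\<close>; beyond that, the parity of \<open>N - c\<close> decides which
  end has an even, smaller partner.\<close>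

lemma arc_color_greedy:
  assumes "arc N u v" "1 \<le> c" "c < arc_color N u v"
  shows "\<exists>x y. arc N x y \<and> arc_color N x y = c \<and> {u, v} \<inter> {x, y} \<noteq> {}"
  using assms(1) refl
proof (cases rule: arc_cases)
  case sum
  then have "arc N u (N - u - c) \<and> arc_color N u (N - u - c) = c"
    using assms(2,3) by (intro arc_sumI) auto
  then show ?thesis by blast
next
  case extra
  then have "c + 2 * u \<le> N + 3" using assms(3) by auto
  then show ?thesis using even_vertex_sees_colors[of u c N] extra assms(2) by blast
next
  case path
  define e w where "e = (if even u then u else v)" and "w = (if even u then v else u)"
  have e: "even e" "4 \<le> e" "e \<in> {u, v}" and w: "odd w" "w \<in> {u, v}" "w \<le> e + 1"
    using path by (auto simp: e_def w_def)
  have c: "c + u \<le> N" using path(4) assms(3) by linarith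
  show ?thesis
  proof (cases "c + 2 * e \<le> N + 3")
    case True
    then show ?thesis using even_vertex_sees_colors[of e c N] e assms(2) by blast
  next
    case False
    show ?thesis
    proof (cases "even (N - c)")
      case True
      \<comment> \<open>The partner \<open>N - c - e\<close> must not be truncated. If
        \<open>e\<close> is \<open>u + 1\<close>, then \<open>c + u = N\<close> would make
        \<open>N - c\<close> odd.\<close>
      have "c + e \<le> N"
      proof (cases "even u")
        case False
        then have "c + u \<noteq> N" using True by auto
        then show ?thesis using c False path(2) by (simp add: e_def)
      qed (use c in \<open>simp add: e_def\<close>)
      then have "arc N (N - c - e) e \<and> arc_color N (N - c - e) e = c"
        using True False e assms(2) by (intro arc_sumI) auto
      then show ?thesis using e by blast
    next
      case odd: False
      have cw: "c + w \<le> N"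
      proof (cases "even u")
        case True
        then have "c + u \<noteq> N" using odd by auto
        then show ?thesis using c True path(2) by (simp add: w_def)
      qed (use c in \<open>simp add: w_def\<close>)
      have "even (N - c - w)" using odd w(1) cw by simp
      \<comment> \<open>This is why \<open>d = 4\<close> is included: for \<open>w = e - 1\<close>
        and \<open>c + 2 * e = N + 3\<close> the partner would be \<open>w - 1\<close>, which is too
        close to \<open>w\<close>.\<close>
      moreover have "N - c - w + 1 < w"
        using False odd w e path(2) cw by (simp add: e_def w_def split: if_splits)
      ultimately have "arc N (N - c - w) w \<and> arc_color N (N - c - w) w = c"
        using cw assms(2) by (intro arc_sumI) auto
      then show ?thesis using w by blast
    qed
  qed
qed

definition arc_edges :: "nat \<Rightarrow> nat set set" where
  "arc_edges N = {{u, v} | u v. arc N u v}"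

definition edge_color :: "nat \<Rightarrow> nat set \<Rightarrow> nat" where
  "edge_color N e = arc_color N (Min e) (Max e)"

lemma edge_color_arc: "arc N u v \<Longrightarrow> edge_color N {u, v} = arc_color N u v"
  using arc_less[of N u v] by (simp add: edge_color_def)

lemma greedy_coloring_arc_edges: "greedy_coloring (arc_edges N) (edge_color N)"
  unfolding greedy_coloring_def
proof (intro ballI conjI allI impI)
  fix e assume "e \<in> arc_edges N"
  then obtain u v where e: "e = {u, v}" and uv: "arc N u v" by (auto simp: arc_edges_def)
  show "1 \<le> edge_color N e" using e uv edge_color_arc arc_color_pos by simp
  show "edge_color N f \<noteq> edge_color N e" if f: "f \<in> arc_edges N" "adjacent_edges e f" for f
  proof -
    obtain x y where xy: "f = {x, y}" "arc N x y" using f(1) by (auto simp: arc_edges_def)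
    then show ?thesis
      using arc_color_proper[OF uv refl xy(2)] e uv f(2) by (auto simp: edge_color_arc adjacent_edges_def)
  qed
  fix c assume c: "1 \<le> c \<and> c < edge_color N e"
  then obtain x y where xy: "arc N x y" "arc_color N x y = c" "{u, v} \<inter> {x, y} \<noteq> {}"
    using arc_color_greedy[OF uv, of c] e uv by (auto simp: edge_color_arc)
  then have "edge_color N {x, y} = c" by (simp add: edge_color_arc)
  moreover have "{x, y} \<noteq> e" using c calculation by auto
  moreover have "{x, y} \<in> arc_edges N" using xy by (auto simp: arc_edges_def)
  ultimately show "\<exists>f\<in>arc_edges N. adjacent_edges e f \<and> edge_color N f = c"
    using xy(3) e by (intro bexI[of _ "{x, y}"]) (auto simp: adjacent_edges_def)
qed

lemma simple_graph_arc_edges: "simple_graph ({..<N + 7}, arc_edges N)"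
  using arc_less arc_bound by (force simp: simple_graph_def arc_edges_def)

section \<open>Counting the edges\<close>

lemma sum_arcs_bound:
  fixes N :: nat
  shows "8 * (\<Sum>i\<le>N div 4. N - 4 * i) \<le> N * N + 7 * N + 12"
proof -
  define q r where "q = N div 4" and "r = N mod 4"
  have N: "N = 4 * q + r" and r: "r \<le> 3" by (auto simp: q_def r_def)
  \<comment> \<open>Removing the first summand from the sum for \<open>m + 1\<close> leaves the sum
    for \<open>m\<close>.\<close>
  have "(\<Sum>i\<le>m. (4 * m + r) - 4 * i) = (m + 1) * (2 * m + r)" for m
  proof (induction m)
    case (Suc m)
    have "(\<Sum>i\<le>Suc m. (4 * Suc m + r) - 4 * i) = 4 * Suc m + r + (\<Sum>i\<le>m. (4 * m + r) - 4 * i)"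
      by (subst sum.atMost_Suc_shift) simp
    also have "\<dots> = (Suc m + 1) * (2 * Suc m + r)" using Suc.IH by (simp add: algebra_simps)
    finally show ?case .
  qed simp
  then have "(\<Sum>i\<le>q. N - 4 * i) = (q + 1) * (2 * q + r)"
    unfolding N .
  then have "8 * (\<Sum>i\<le>N div 4. N - 4 * i) = 8 * ((q + 1) * (2 * q + r))"
    by (simp only: q_def)
  also have "\<dots> \<le> N * N + 7 * N + 12"
  proof -
    have "r \<in> {0, 1, 2, 3}" using r by auto
    then show ?thesis unfolding N by (auto simp: algebra_simps)
  qed
  finally show ?thesis .
qed

text \<open>For \<open>u = 2 * i\<close> the partners lie in an interval of length
  \<open>N - 4 * i\<close>; that it also contains \<open>u\<close> and \<open>u + 1\<close> costs
  only a linear term. Path and extra edges add at most \<open>5 * (N + 1)\<close>.\<close>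

lemma card_arc_edges: "8 * card (arc_edges N) \<le> N * N + 47 * N + 100"
proof -
  define A where "A = (SIGMA i:{..N div 4}. {2 * i..<N - 2 * i})"
  define B where "B = {..N} \<times> {0, 1, 2, 4::nat}"
  have "arc_edges N \<subseteq> (\<lambda>(i, v). {2 * i, v}) ` A \<union> (\<lambda>u. {u, u + 1}) ` {..N}
      \<union> (\<lambda>(u, d). {u, N + 2 + d}) ` B"
  proof
    fix e assume "e \<in> arc_edges N"
    then obtain u v where e: "e = {u, v}" and "arc N u v" by (auto simp: arc_edges_def)
    then consider "even u" "u + 1 < v" "u + v < N" | "v = u + 1" "u \<le> N"
      | d where "d \<in> {0, 1, 2, 4}" "v = N + 2 + d" "4 \<le> u" "2 * u + 2 \<le> N + d"
      unfolding arc_def by blast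
    then show "e \<in> (\<lambda>(i, v). {2 * i, v}) ` A \<union> (\<lambda>u. {u, u + 1}) ` {..N}
      \<union> (\<lambda>(u, d). {u, N + 2 + d}) ` B"
    proof cases
      case 1
      then have "(u div 2, v) \<in> A" by (auto simp: A_def)
      moreover have "e = (\<lambda>(i, v). {2 * i, v}) (u div 2, v)" using e 1 by simp
      ultimately show ?thesis by blast
    next
      case 2
      then show ?thesis using e by auto
    next
      case 3
      then have "(u, d) \<in> B" by (auto simp: B_def)
      moreover have "e = (\<lambda>(u, d). {u, N + 2 + d}) (u, d)" using e 3 by simp
      ultimately show ?thesis by blast
    qed
  qed
  moreover have fin: "finite A" "finite B" by (auto simp: A_def B_def)
  ultimately have "card (arc_edges N) \<le> card ((\<lambda>(i, v). {2 * i, v}) ` A \<union> (\<lambda>u. {u, u + 1}) ` {..N}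
      \<union> (\<lambda>(u, d). {u, N + 2 + d}) ` B)"
    by (intro card_mono) auto
  also have "\<dots> \<le> card A + card {..N} + card B"
    using fin by (intro order.trans[OF card_Un_le] add_mono card_image_le) auto
  also have "card A = (\<Sum>i\<le>N div 4. N - 4 * i)" unfolding A_def by simp
  also have "card B = (N + 1) * 4" unfolding B_def by (simp add: card_cartesian_product)
  finally show ?thesis using sum_arcs_bound[of N] by simp
qed

section \<open>The rainbow path and the asymptotics\<close>

lemma rainbow_path_exists:
  assumes "k \<ge> 1"
  obtains G :: "nat graph" and es K where "presents es G" "is_copy (path_graph k) G K"
    "rainbow (first_fit es) K" "8 * length es \<le> k * k + 53 * k + 250"
proof -
  \<comment> \<open>The path runs through \<open>4, ..., N + 1\<close>, so it has
    \<open>N - 3 = k\<close> edges, with colours \<open>k, ..., 1\<close>.\<close>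
  define N where "N = k + 3"
  have sg: "simple_graph ({..<N + 7}, arc_edges N)" by (rule simple_graph_arc_edges)
  have fin: "finite (arc_edges N)"
    using sg by (auto simp: simple_graph_def intro: finite_subset[of _ "Pow {..<N + 7}"])
  obtain es where es: "distinct es" "set es = arc_edges N"
    "\<And>e. e \<in> arc_edges N \<Longrightarrow> first_fit es e = Some (edge_color N e)"
    using first_fit_realizes_greedy_coloring[OF fin greedy_coloring_arc_edges] by blast
  define Q where "Q = (\<lambda>i. {i, i + 1}) ` {4..N}"
  have arcQ: "arc N i (i + 1)" "arc_color N i (i + 1) = N + 1 - i" if "i \<in> {4..N}" for i
    using that by (auto simp: arc_def arc_color_def)
  define K :: "nat graph" where "K = ({4..N + 1}, Q)"
  have Q: "Q \<subseteq> arc_edges N" using arcQ(1) unfolding Q_def arc_edges_def by blast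
  have "simple_graph K"
    by (auto simp: K_def Q_def simple_graph_def)
  then have sub: "subgraph K ({..<N + 7}, arc_edges N)"
    using Q by (auto simp: K_def subgraph_def)
  have "bij_betw (\<lambda>i. i + 4) {0..k} {4..N + 1}"
    by (rule bij_betw_byWitness[where f' = "\<lambda>i. i - 4"]) (auto simp: N_def)
  moreover have "Q = (\<lambda>e. (\<lambda>i. i + 4) ` e) ` {{i, Suc i} |i. i < k}"
  proof -
    have "x \<in> (\<lambda>i. i + 4) ` {..<k}" if "x \<in> {4..N}" for x
      using that by (intro image_eqI[of _ _ "x - 4"]) (auto simp: N_def)
    then have "{4..N} = (\<lambda>i. i + 4) ` {..<k}" by (auto simp: N_def)
    then have "Q = (\<lambda>i. {i + 4, i + 5}) ` {..<k}"
      by (simp add: Q_def image_image numeral_eq_Suc)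
    also have "\<dots> = (\<lambda>e. (\<lambda>i. i + 4) ` e) ` (\<lambda>i. {i, Suc i}) ` {..<k}"
      by (simp add: image_image numeral_eq_Suc)
    also have "(\<lambda>i. {i, Suc i}) ` {..<k} = {{i, Suc i} |i. i < k}" by auto
    finally show ?thesis .
  qed
  ultimately have copy: "is_copy (path_graph k) ({..<N + 7}, arc_edges N) K"
    using sub by (auto simp: is_copy_def isomorphic_def path_graph_def K_def)
  have "rainbow (first_fit es) K"
    unfolding rainbow_def
  proof (rule inj_onI)
    fix e f assume ef: "e \<in> edges K" "f \<in> edges K" "first_fit es e = first_fit es f"
    then obtain i j where i: "e = {i, i + 1}" "i \<in> {4..N}" and j: "f = {j, j + 1}" "j \<in> {4..N}"
      by (auto simp: K_def Q_def)
    have "edge_color N e = edge_color N f" using ef es(3) Q by (simp add: K_def subset_iff)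
    then have "N + 1 - i = N + 1 - j" using i j arcQ edge_color_arc by metis
    then show "e = f" using i j by auto
  qed
  moreover have "presents es ({..<N + 7}, arc_edges N)" using sg es by (simp add: presents_def)
  moreover have "8 * length es \<le> k * k + 53 * k + 250"
    using card_arc_edges[of N] es distinct_card[of es] by (simp add: N_def algebra_simps)
  ultimately show thesis using that copy by blast
qed

lemma AR_FF_path_bounds:
  assumes "k \<ge> 1"
  shows "k * k \<le> 8 * AR_FF (path_graph k)"
    and "8 * AR_FF (path_graph k) \<le> k * k + 53 * k + 250"
proof -
  define P where "P t \<longleftrightarrow> (\<exists>(G :: nat graph) es. presents es G \<and> length es = t \<and>
    (\<exists>K. is_copy (path_graph k) G K \<and> rainbow (first_fit es) K))" for t
  have AR: "AR_FF (path_graph k) = Least P" by (simp add: AR_FF_def P_def[abs_def])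
  obtain t where t: "P t" "8 * t \<le> k * k + 53 * k + 250"
    using rainbow_path_exists[OF assms] unfolding P_def by metis
  show "8 * AR_FF (path_graph k) \<le> k * k + 53 * k + 250"
    using Least_le[of P t] t AR by linarith
  \<comment> \<open>The lower bound also relies on the construction: the \<open>LEAST\<close> in
    \<open>AR_FF\<close> is attained because some \<open>t\<close> satisfies
    \<open>P\<close>.\<close>
  have "P (Least P)" using t(1) by (rule LeastI)
  then show "k * k \<le> 8 * AR_FF (path_graph k)"
    unfolding AR P_def using rainbow_path_lower_bound by metis
qed

theorem theorem13:
  "\<exists>\<epsilon> :: nat \<Rightarrow> real. \<epsilon> \<longlonglongrightarrow> 0 \<and>
     (\<forall>k\<ge>1. real (AR_FF (path_graph k)) = (real k)\<^sup>2 / 8 * (1 + \<epsilon> k))"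
proof (intro exI conjI allI impI)
  define \<epsilon> where "\<epsilon> k = 8 * real (AR_FF (path_graph k)) / (real k)\<^sup>2 - 1" for k
  show "real (AR_FF (path_graph k)) = (real k)\<^sup>2 / 8 * (1 + \<epsilon> k)" if "k \<ge> 1" for k
    using that by (simp add: \<epsilon>_def)
  \<comment> \<open>Here 303 is 53 + 250, the constant 250 being absorbed into
    \<open>250 * k\<close> for \<open>k \<ge> 1\<close>.\<close>
  have bounds: "0 \<le> \<epsilon> k \<and> \<epsilon> k \<le> 303 / real k" if k: "k \<ge> 1" for k
  proof -
    have "real (k * k) \<le> real (8 * AR_FF (path_graph k))"
      "real (8 * AR_FF (path_graph k)) \<le> real (k * k + 303 * k)"
      using AR_FF_path_bounds[OF k] k by (intro of_nat_mono; linarith)+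
    then have "1 \<le> 8 * real (AR_FF (path_graph k)) / (real k)\<^sup>2"
      "8 * real (AR_FF (path_graph k)) / (real k)\<^sup>2 \<le> real (k * k + 303 * k) / (real k)\<^sup>2"
      using k by (auto intro: divide_right_mono simp: power2_eq_square)
    moreover have "real (k * k + 303 * k) / (real k)\<^sup>2 = 1 + 303 / real k"
      using k by (simp add: field_simps power2_eq_square)
    ultimately show ?thesis by (simp add: \<epsilon>_def)
  qed
  show "\<epsilon> \<longlonglongrightarrow> 0"
  proof (rule tendsto_sandwich[of "\<lambda>_. 0" _ _ "\<lambda>k. 303 / real k"])
    show "\<forall>\<^sub>F k in sequentially. 0 \<le> \<epsilon> k" "\<forall>\<^sub>F k in sequentially. \<epsilon> k \<le> 303 / real k"
      using bounds by (auto intro: eventually_sequentiallyI[of 1])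
    show "(\<lambda>k. 303 / real k) \<longlonglongrightarrow> 0" by (rule lim_const_over_n)
  qed simp
qed

end
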